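(* Let $\mathcal{H}$ be a real Hilbert space and let $A:\mathcal{H}\to2^{\mathcal{H}}$ be maximally monotone with $\operatorname{zer}A\neq\varnothing$. Let $x_0\in\mathcal{H}$, and for every $k\in\mathbb{N}$ let $\lambda_k\in(0,2)$ and $c_k\in(0,\infty)$, with $c:=\inf_{k\in\mathbb{N}}c_k>0$. Define $$(\forall k\in\mathbb{N})\quad x_{k+1}=(1-\lambda_k)x_k+\lambda_kJ_{c_kA}x_k .$$ Then the following hold. (i) $(x_k)_{k\in\mathbb{N}}$ is Fejér monotone with respect to $\operatorname{zer}A$. (ii) Let $\bar x\in\operatorname{zer}A$. Suppose that $A$ is metrically subregular at $\bar x$ for $0\in A\bar x$, i.e. there exist $\kappa>0$ and $\delta>0$ such that $$(\forall x\in B[\bar x;\delta])\quad \operatorname{d}(x,A^{-1}0)\le\kappa\operatorname{d}(0,Ax).$$ Suppose that $x_0\in B[\bar x;\delta]$. Define, for every $k\in\mathbb{N}$, $\gamma_k:=1+\frac{\kappa}{c_k}$ and $\rho_k:=\left(1-\frac{\lambda_k(2-\lambda_k)}{\gamma_k^2}\right)^{1/2}$. Then: (a) for every $k\in\mathbb{N}$, $x_k\in B[\bar x;\delta]$ and $\operatorname{d}(x_{k+1},\operatorname{zer}A)\le\rho_k\operatorname{d}(x_k,\operatorname{zer}A)$. (b) Suppose that $0<\underline\lambda:=\liminf_{k\to\infty}\lambda_k\le\overline\lambda:=\limsup_{k\to\infty}\lambda_k<2$. Define $\rho:=\limsup_{k\to\infty}\rho_k$ and $\gamma:=\limsup_{k\to\infty}\gamma_k$.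 Then: (b.i) $0\le\rho\le\left(1-\frac{\underline\lambda(2-\overline\lambda)}{\gamma^2}\right)^{1/2}<\frac{1}{\left(1+\frac{\underline\lambda(2-\overline\lambda)}{\gamma^2}\right)^{1/2}}<1$; (b.ii) there exist $K\in\mathbb{N}$ and $\mu\in(\rho,1)$ such that $\operatorname{d}(x_{k+1},\operatorname{zer}A)\le\mu\operatorname{d}(x_k,\operatorname{zer}A)$ for every $k\ge K$; (b.iii) there exist $\hat x\in\operatorname{zer}A$, $K\in\mathbb{N}$ and $\mu\in(\rho,1)$ such that $$(\forall k\ge K)\quad \|x_k-\hat x\|\le2\mu^{k-K}\operatorname{d}(x_K,\operatorname{zer}A);$$ consequently, $(x_k)_{k\in\mathbb{N}}$ converges $R$-linearly to a point $\hat x\in\operatorname{zer}A$. In addition, if $\operatorname{zer}A$ is affine, then $\hat x=\operatorname{P}_{\operatorname{zer}A}x_0$.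
   Context: $\mathbb{N}=\{0,1,2,\ldots\}$. A set-valued operator $A:\mathcal{H}\to2^{\mathcal{H}}$ is monotone if $\langle x-y,u-v\rangle\ge0$ whenever $u\in Ax$, $v\in Ay$, and maximally monotone if no monotone operator has a graph properly containing that of $A$. $\operatorname{zer}A=A^{-1}0=\{x\in\mathcal{H}:0\in Ax\}$. For $c>0$, $J_{cA}=(\operatorname{Id}+cA)^{-1}$ is the resolvent, which for maximally monotone $A$ is single-valued and defined on all of $\mathcal{H}$. $B[\bar x;r]=\{y:\|y-\bar x\|\le r\}$; $\operatorname{d}(x,C)=\inf_{y\in C}\|x-y\|$ (equal to $+\infty$ if $C=\varnothing$); $\operatorname{P}_C$ is the projection onto a nonempty closed convex set $C$. A nonempty set $C$ is affine if $\lambda x+(1-\lambda)y\in C$ for all $x,y\in C$, $\lambda\in\mathbb{R}$. $(x_k)$ is Fejér monotone with respect to $C$ if $\|x_{k+1}-x\|\le\|x_k-x\|$ for all $x\in C$, $k\in\mathbb{N}$. A sequence $(y_k)$ converging to $\bar y$ converges $R$-linearly to $\bar y$ if $\limsup_{k\to\infty}\|y_k-\bar y\|^{1/k}<1$. *)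

theory Defs
  imports "HOL-Analysis.Analysis"
begin

(* A real Hilbert space is a type of sort {real_inner, complete_space};
   a set-valued operator on it is a function 'a \<Rightarrow> 'a set. *)

definition op_graph :: "('a \<Rightarrow> 'b set) \<Rightarrow> ('a \<times> 'b) set" where
  "op_graph A = {(x, u). u \<in> A x}"

definition op_inverse :: "('a \<Rightarrow> 'b set) \<Rightarrow> 'b \<Rightarrow> 'a set" where
  "op_inverse A u = {x. u \<in> A x}"

definition zer :: "('a \<Rightarrow> 'b::zero set) \<Rightarrow> 'a set" where
  "zer A = op_inverse A 0"

definition monotone_operator :: "('a::real_inner \<Rightarrow> 'a set) \<Rightarrow> bool" where
  "monotone_operator A \<longleftrightarrow>
     (\<forall>x y. \<forall>u\<in>A x. \<forall>v\<in>A y. inner (x - y) (u - v) \<ge> 0)"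

definition maximally_monotone :: "('a::real_inner \<Rightarrow> 'a set) \<Rightarrow> bool" where
  "maximally_monotone A \<longleftrightarrow>
     monotone_operator A \<and> \<not> (\<exists>B. monotone_operator B \<and> op_graph A \<subset> op_graph B)"

definition resolvent_op :: "real \<Rightarrow> ('a::real_vector \<Rightarrow> 'a set) \<Rightarrow> 'a \<Rightarrow> 'a set" where
  "resolvent_op c A = op_inverse (\<lambda>x. {x + c *\<^sub>R u |u. u \<in> A x})"

(* For c > 0 and maximally monotone A on a Hilbert space, all values of resolvent_op c A are
   singletons (Minty); the function below picks the element. *)
definition resolvent :: "real \<Rightarrow> ('a::real_vector \<Rightarrow> 'a set) \<Rightarrow> 'a \<Rightarrow> 'a" where
  "resolvent c A x = the_elem (resolvent_op c A x)"

(* Extended-real valued, so that the distance to the empty set is \<infinity>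
   (the library's infdist is 0 there). *)
definition edist_set :: "'a::real_normed_vector \<Rightarrow> 'a set \<Rightarrow> ereal" where
  "edist_set x C = (INF y\<in>C. ereal (norm (x - y)))"

lemma edist_set_empty: "edist_set x {} = \<infinity>"
  by (simp add: edist_set_def top_ereal_def)

lemma edist_set_eq_infdist:
  assumes "C \<noteq> {}"
  shows "edist_set x C = ereal (infdist x C)"
proof (rule antisym)
  show "ereal (infdist x C) \<le> edist_set x C"
    unfolding edist_set_def by (auto intro!: INF_greatest simp flip: dist_norm intro: infdist_le)
  show "edist_set x C \<le> ereal (infdist x C)"
  proof (rule ereal_le_epsilon2)
    fix e :: real assume "e > 0"
    moreover have "infdist x C = (INF y\<in>C. dist x y)"
      using assms by (simp add: infdist_def)
    ultimately have "\<exists>y\<in>C. dist x y < infdist x C + e"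
      using assms cINF_less_iff[of C "dist x" "infdist x C + e"]
      by (auto intro: bdd_belowI2[of _ 0])
    then obtain y where y: "y \<in> C" "dist x y < infdist x C + e" by blast
    have "edist_set x C \<le> ereal (norm (x - y))"
      unfolding edist_set_def using y(1) by (rule INF_lower)
    with y(2) show "edist_set x C \<le> ereal (infdist x C) + ereal e"
      by (auto simp: dist_norm intro: order_trans)
  qed
qed

(* The library's closest_point is restricted to Heine-Borel spaces. *)
definition metric_projection :: "'a::real_normed_vector set \<Rightarrow> 'a \<Rightarrow> 'a" where
  "metric_projection C x = (THE p. p \<in> C \<and> (\<forall>y\<in>C. norm (x - p) \<le> norm (x - y)))"

definition fejer_monotone :: "(nat \<Rightarrow> 'a::real_normed_vector) \<Rightarrow> 'a set \<Rightarrow> bool" where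
  "fejer_monotone x C \<longleftrightarrow> (\<forall>z\<in>C. \<forall>k. norm (x (Suc k) - z) \<le> norm (x k - z))"

(* A is metrically subregular at xb for ub, with constants kappa and delta. *)
definition metrically_subregular_with ::
    "('a::real_normed_vector \<Rightarrow> 'a set) \<Rightarrow> 'a \<Rightarrow> 'a \<Rightarrow> real \<Rightarrow> real \<Rightarrow> bool" where
  "metrically_subregular_with A xb ub \<kappa> \<delta> \<longleftrightarrow>
     ub \<in> A xb \<and> \<kappa> > 0 \<and> \<delta> > 0 \<and>
     (\<forall>x\<in>cball xb \<delta>. edist_set x (op_inverse A ub) \<le> ereal \<kappa> * edist_set ub (A x))"

(* limsup and liminf live in complete lattices, hence the detour through ereal; the results are
   meaningful for bounded sequences, see the two lemmas. *)
definition real_limsup :: "(nat \<Rightarrow> real) \<Rightarrow> real" where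
  "real_limsup f = real_of_ereal (limsup (\<lambda>k. ereal (f k)))"

definition real_liminf :: "(nat \<Rightarrow> real) \<Rightarrow> real" where
  "real_liminf f = real_of_ereal (liminf (\<lambda>k. ereal (f k)))"

lemma ereal_real_limsup:
  assumes "\<And>k. a \<le> f k" "\<And>k. f k \<le> b"
  shows "ereal (real_limsup f) = limsup (\<lambda>k. ereal (f k))"
proof -
  have "ereal a \<le> limsup (\<lambda>k. ereal (f k))" "limsup (\<lambda>k. ereal (f k)) \<le> ereal b"
    using assms by (auto intro!: le_Limsup Limsup_bounded)
  then show ?thesis
    unfolding real_limsup_def by (cases "limsup (\<lambda>k. ereal (f k))") auto
qed

lemma ereal_real_liminf:
  assumes "\<And>k. a \<le> f k" "\<And>k. f k \<le> b"
  shows "ereal (real_liminf f) = liminf (\<lambda>k. ereal (f k))"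
proof -
  have "ereal a \<le> liminf (\<lambda>k. ereal (f k))" "liminf (\<lambda>k. ereal (f k)) \<le> ereal b"
    using assms by (auto intro!: Liminf_le Liminf_bounded)
  then show ?thesis
    unfolding real_liminf_def by (cases "liminf (\<lambda>k. ereal (f k))") auto
qed

definition converges_R_linearly :: "(nat \<Rightarrow> 'a::real_normed_vector) \<Rightarrow> 'a \<Rightarrow> bool" where
  "converges_R_linearly y yb \<longleftrightarrow>
     y \<longlonglongrightarrow> yb \<and> limsup (\<lambda>k. ereal (root k (norm (y k - yb)))) < 1"

end

theory Submission
  imports Defs
begin

text \<open>Everything rests on the decrease
  \<open>\<parallel>x (k+1) - z\<parallel>\<^sup>2 \<le> \<parallel>x k - z\<parallel>\<^sup>2 - \<lambda> (2 - \<lambda>) \<parallel>x k - J (x k)\<parallel>\<^sup>2\<close> for every zero \<open>z\<close>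
  (\<open>relaxed_step_decrease\<close>), which is monotonicity of \<open>A\<close> between \<open>z\<close> and the resolvent \<open>J (x k)\<close>.
  It gives Fejer monotonicity at once, and so keeps the sequence in the ball around \<open>xb\<close>.
  Metric subregularity at \<open>J (x k)\<close> bounds the residual \<open>\<parallel>x k - J (x k)\<parallel>\<close> from below by the distance
  of \<open>x k\<close> to the zeros divided by \<open>1 + \<kappa> / c k\<close>. Inserted into the decrease, this contracts the
  distance by the factor \<open>\<rho> k\<close> (\<open>relaxed_step_contraction\<close>).

  When the relaxation parameters stay away from 0 and 2, the factors are eventually below some
  \<open>\<mu> < 1\<close>, so the distances decay geometrically. A Fejer monotone sequence moves, from time \<open>k\<close> on,
  by at most twice its distance to the set; hence it is Cauchy and inherits the geometric rate
  (\<open>fejer_monotone_convergent\<close>). If the set of zeros is affine, Fejer monotonicity with respect to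
  points arbitrarily far out makes \<open>x 0 - xh\<close> orthogonal to it (\<open>fejer_monotone_affine_limit\<close>).

  For the resolvent to be a function at all, \<open>Id + c A\<close> has to be surjective: this is Minty's theorem,
  obtained from the Fitzpatrick function of \<open>A\<close> and completeness (\<open>minty_at_origin\<close>). The lemma treats
  only \<open>c = 1\<close> and the origin; scaling and translating the operator gives the rest.\<close>

section \<open>Minty's theorem and the resolvent\<close>

lemma maximally_monotone_monotone:
  assumes "maximally_monotone A" "u \<in> A x" "v \<in> A y"
  shows "inner (x - y) (u - v) \<ge> 0"
  using assms unfolding maximally_monotone_def monotone_operator_def by blast

text \<open>The working form of maximality: a point monotonically related to the whole graph could be
  added to it.\<close>

lemma maximally_monotone_memI:
  assumes A: "maximally_monotone A"
    and rel: "\<And>y v. v \<in> A y \<Longrightarrow> inner (x - y) (u - v) \<ge> 0"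
  shows "u \<in> A x"
proof (rule ccontr)
  assume u: "u \<notin> A x"
  define B where "B = A(x := insert u (A x))"
  have B_iff: "v \<in> B y \<longleftrightarrow> v \<in> A y \<or> (y = x \<and> v = u)" for y v
    by (auto simp: B_def)
  have swap: "inner (y - x) (v - u) = inner (x - y) (u - v)" for y v
    by (simp add: inner_diff_left inner_diff_right)
  have "monotone_operator B"
    unfolding monotone_operator_def
    using rel swap maximally_monotone_monotone[OF A] by (auto simp: B_iff)
  moreover have "op_graph A \<subset> op_graph B"
    using u by (auto simp: op_graph_def B_iff)
  ultimately show False
    using A unfolding maximally_monotone_def by blast
qed

text \<open>The quadratic term makes the objective strongly convex, so by the parallelogram law every
  minimising sequence is Cauchy, and completeness provides the minimiser. Reading \<open>E\<close> as the epigraph of a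
  lower semicontinuous convex function, the conclusion is the optimality condition that minus the
  minimiser is a subgradient at the minimiser.\<close>

lemma regularised_epigraph_minimiser:
  fixes E :: "('b::{real_inner,complete_space} \<times> real) set"
  assumes "closed E" "convex E" "E \<noteq> {}"
    and bdd: "\<And>p t. (p, t) \<in> E \<Longrightarrow> b \<le> t + (norm p)\<^sup>2 / 2"
  obtains p t where "(p, t) \<in> E" "\<And>q s. (q, s) \<in> E \<Longrightarrow> t \<le> s + inner p (q - p)"
proof -
  define \<phi> where "\<phi> z = snd z + (norm (fst z))\<^sup>2 / 2" for z :: "'b \<times> real"
  define m where "m = Inf (\<phi> ` E)"
  have bddE: "bdd_below (\<phi> ` E)"
    using bdd by (intro bdd_belowI[of _ b]) (auto simp: \<phi>_def)
  have m_le: "m \<le> \<phi> z" if "z \<in> E" for z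
    unfolding m_def using that bddE by (intro cInf_lower) auto
  have "\<exists>z\<in>E. \<phi> z < m + 1 / real (Suc n)" for n
  proof -
    have "Inf (\<phi> ` E) < m + 1 / real (Suc n)" by (simp add: m_def)
    then show ?thesis
      using cInf_lessD[of "\<phi> ` E"] assms(3) by blast
  qed
  then obtain Z where Z: "\<And>n. Z n \<in> E" "\<And>n. \<phi> (Z n) < m + 1 / real (Suc n)"
    by metis
  have gap: "(norm (fst z - fst w))\<^sup>2 / 4 \<le> \<phi> z + \<phi> w - 2 * m" if "z \<in> E" "w \<in> E" for z w
  proof -
    have "(1/2) *\<^sub>R z + (1/2) *\<^sub>R w \<in> E"
      using assms(2) that by (intro convexD) auto
    then have "m \<le> \<phi> ((1/2) *\<^sub>R z + (1/2) *\<^sub>R w)" by (rule m_le)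
    then show ?thesis
      unfolding \<phi>_def power2_norm_eq_inner
      by (simp add: inner_add_left inner_add_right inner_diff_left inner_diff_right
          inner_commute field_simps)
  qed
  have "Cauchy (\<lambda>n. fst (Z n))"
  proof (rule metric_CauchyI)
    fix e :: real assume e: "e > 0"
    obtain N where N: "1 / real (Suc N) < e\<^sup>2 / 8"
      using reals_Archimedean[of "e\<^sup>2 / 8"] e by (auto simp: inverse_eq_divide)
    have small: "\<phi> (Z n) < m + e\<^sup>2 / 8" if "n \<ge> N" for n
    proof -
      have "1 / real (Suc n) \<le> 1 / real (Suc N)" using that by (simp add: frac_le)
      with Z(2)[of n] N show ?thesis by linarith
    qed
    have "dist (fst (Z i)) (fst (Z j)) < e" if "i \<ge> N" "j \<ge> N" for i j
    proof -
      have "(norm (fst (Z i) - fst (Z j)))\<^sup>2 < e\<^sup>2"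
        using gap[OF Z(1) Z(1), of i j] small[OF that(1)] small[OF that(2)] by linarith
      then show ?thesis
        using e by (simp add: dist_norm power_less_imp_less_base)
    qed
    then show "\<exists>N. \<forall>i\<ge>N. \<forall>j\<ge>N. dist (fst (Z i)) (fst (Z j)) < e" by blast
  qed
  then obtain p where p: "(\<lambda>n. fst (Z n)) \<longlonglongrightarrow> p"
    using Cauchy_convergent convergent_def by blast
  define t where "t = m - (norm p)\<^sup>2 / 2"
  have "(\<lambda>n. \<phi> (Z n)) \<longlonglongrightarrow> m"
  proof (rule tendsto_sandwich[of "\<lambda>_. m" _ _ "\<lambda>n. m + 1 / real (Suc n)"])
    show "(\<lambda>n. m + 1 / real (Suc n)) \<longlonglongrightarrow> m"
      using tendsto_add[OF tendsto_const[of m] LIMSEQ_inverse_real_of_nat]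
      by (simp add: inverse_eq_divide)
  qed (use Z m_le in \<open>auto intro!: always_eventually less_imp_le\<close>)
  then have "(\<lambda>n. \<phi> (Z n) - (norm (fst (Z n)))\<^sup>2 / 2) \<longlonglongrightarrow> t"
    unfolding t_def by (intro tendsto_intros p) auto
  then have "(\<lambda>n. snd (Z n)) \<longlonglongrightarrow> t" by (simp add: \<phi>_def)
  with p have "(\<lambda>n. (fst (Z n), snd (Z n))) \<longlonglongrightarrow> (p, t)" by (rule tendsto_Pair)
  then have "Z \<longlonglongrightarrow> (p, t)" by simp
  with assms(1) Z(1) have pt: "(p, t) \<in> E" by (rule closed_sequentially)
  have "t \<le> s + inner p (q - p)" if qs: "(q, s) \<in> E" for q s
  proof (rule field_le_epsilon)
    fix e :: real assume e: "e > 0"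
    define n where "n = (norm (q - p))\<^sup>2"
    \<comment> \<open>Comparing with the point at parameter \<open>\<tau>\<close> of the segment towards \<open>(q, s)\<close> leaves an error
      of \<open>\<tau> * n / 2\<close>.\<close>
    define \<tau> where "\<tau> = min 1 (e / (n + 1))"
    have n: "n \<ge> 0" by (simp add: n_def)
    have \<tau>: "0 < \<tau>" "\<tau> \<le> 1" "\<tau> \<le> e / (n + 1)" using e n by (auto simp: \<tau>_def)
    have "(1 - \<tau>) *\<^sub>R (p, t) + \<tau> *\<^sub>R (q, s) \<in> E"
      using assms(2) pt qs \<tau> by (intro convexD) auto
    then have "m \<le> \<phi> ((1 - \<tau>) *\<^sub>R (p, t) + \<tau> *\<^sub>R (q, s))" by (rule m_le)
    also have "(1 - \<tau>) *\<^sub>R (p, t) + \<tau> *\<^sub>R (q, s) = (p + \<tau> *\<^sub>R (q - p), t + \<tau> * (s - t))"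
      by (simp add: algebra_simps)
    also have "\<phi> \<dots> = t + \<tau> * (s - t) + ((norm p)\<^sup>2 + 2 * \<tau> * inner p (q - p) + \<tau>\<^sup>2 * n) / 2"
      unfolding \<phi>_def n_def fst_conv snd_conv power2_norm_eq_inner
      by (simp add: inner_add_left inner_add_right inner_commute power2_eq_square algebra_simps)
    finally have "0 \<le> \<tau> * (s - t + inner p (q - p) + \<tau> * n / 2)"
      by (simp add: t_def field_simps power2_eq_square)
    then have "0 \<le> s - t + inner p (q - p) + \<tau> * n / 2"
      using \<tau>(1) by (simp add: zero_le_mult_iff)
    moreover have "\<tau> * n / 2 \<le> e"
    proof -
      have "\<tau> * n \<le> \<tau> * (n + 1)" using \<tau> by (simp add: mult_left_mono)
      also have "\<dots> \<le> e" using \<tau>(3) n by (simp add: pos_le_divide_eq)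
      finally show ?thesis using e by linarith
    qed
    ultimately show "t \<le> s + inner p (q - p) + e" by linarith
  qed
  with pt that show ?thesis by blast
qed

text \<open>Surjectivity of \<open>Id + A\<close> at the origin, after Simons and Zalinescu. The set \<open>E\<close> is the
  epigraph of the Fitzpatrick function
  \<open>F (x, u) = sup {\<langle>x, v\<rangle> + \<langle>y, u\<rangle> - \<langle>y, v\<rangle>}\<close>, the supremum being over the graph of \<open>A\<close>.
  Maximality says \<open>F (x, u) \<ge> \<langle>x, u\<rangle>\<close>, so \<open>F\<close> plus half the squared norm is nonnegative.
  Testing the optimality condition at its minimiser against the graph, where \<open>F\<close> equals the pairing,
  shows that the reflected minimiser is monotonically related to the graph, hence belongs to it.\<close>

lemma minty_at_origin:
  fixes A :: "'a::{real_inner,complete_space} \<Rightarrow> 'a set"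
  assumes A: "maximally_monotone A"
  shows "\<exists>x. - x \<in> A x"
proof -
  define E where "E = (\<Inter>(y, v)\<in>op_graph A.
    {z :: ('a \<times> 'a) \<times> real. inner (fst (fst z)) v + inner y (snd (fst z)) - inner y v \<le> snd z})"
  have E_iff: "((x, u), t) \<in> E \<longleftrightarrow>
      (\<forall>y v. v \<in> A y \<longrightarrow> inner x v + inner y u - inner y v \<le> t)" for x u t
    by (auto simp: E_def op_graph_def)
  have "closed E"
    unfolding E_def by (auto intro!: closed_INT closed_Collect_le continuous_intros)
  have "convex E"
  proof (rule convexI)
    fix z w :: "('a \<times> 'a) \<times> real" and a b :: real
    assume zw: "z \<in> E" "w \<in> E" and ab: "0 \<le> a" "0 \<le> b" "a + b = 1"
    obtain x u t x' u' t' where eqs: "z = ((x, u), t)" "w = ((x', u'), t')"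
      by (metis prod.collapse)
    have "inner (a *\<^sub>R x + b *\<^sub>R x') v + inner y (a *\<^sub>R u + b *\<^sub>R u') - inner y v \<le> a * t + b * t'"
      if v: "v \<in> A y" for y v
    proof -
      have "a * (inner x v + inner y u - inner y v) + b * (inner x' v + inner y u' - inner y v)
          \<le> a * t + b * t'"
        using zw v ab unfolding eqs E_iff by (intro add_mono mult_left_mono) auto
      moreover have "a * inner y v + b * inner y v = inner y v"
        using ab(3) by (simp flip: distrib_right)
      ultimately show ?thesis
        by (simp add: inner_add_left inner_add_right algebra_simps)
    qed
    then show "a *\<^sub>R z + b *\<^sub>R w \<in> E"
      by (simp add: eqs E_iff)
  qed
  have graph: "((y, v), inner y v) \<in> E" if "v \<in> A y" for y v
    unfolding E_iff
  proof (intro allI impI)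
    fix y' v' assume "v' \<in> A y'"
    from maximally_monotone_monotone[OF A that this]
    show "inner y v' + inner y' v - inner y' v' \<le> inner y v"
      by (simp add: inner_diff_left inner_diff_right)
  qed
  \<comment> \<open>If the graph were empty, every point would be monotonically related to it.\<close>
  have "\<exists>y v. v \<in> A y"
    using maximally_monotone_memI[OF A, of 0 0] by blast
  with graph have "E \<noteq> {}" by blast
  have fitz: "inner x u \<le> t" if "((x, u), t) \<in> E" for x u t
  proof (rule ccontr)
    assume t: "\<not> inner x u \<le> t"
    have "u \<in> A x"
    proof (rule maximally_monotone_memI[OF A])
      fix y v assume "v \<in> A y"
      with that have "inner x v + inner y u - inner y v \<le> t" by (simp add: E_iff)
      with t show "inner (x - y) (u - v) \<ge> 0"
        by (simp add: inner_diff_left inner_diff_right)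
    qed
    with that have "inner x u + inner x u - inner x u \<le> t" unfolding E_iff by blast
    with t show False by simp
  qed
  have sq: "0 \<le> inner x x + inner u u + 2 * inner x u" for x u :: 'a
    using inner_ge_zero[of "x + u"] by (simp add: inner_add_left inner_add_right inner_commute)
  have "0 \<le> t + (norm z)\<^sup>2 / 2" if "(z, t) \<in> E" for z t
  proof -
    obtain x u where z: "z = (x, u)" by (cases z)
    have "inner x u \<le> t" using fitz that by (simp add: z)
    moreover have "(norm z)\<^sup>2 = inner x x + inner u u" by (simp add: z power2_norm_eq_inner)
    ultimately show ?thesis using sq[of x u] by linarith
  qed
  then obtain z t where zt: "(z, t) \<in> E" "\<And>q s. (q, s) \<in> E \<Longrightarrow> t \<le> s + inner z (q - z)"
    using regularised_epigraph_minimiser[OF \<open>closed E\<close> \<open>convex E\<close> \<open>E \<noteq> {}\<close>, of 0] by blast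
  obtain x u where z: "z = (x, u)" by (cases z)
  have ineq: "inner (y + u) (v + x) \<ge> inner (x + u) (x + u)" if v: "v \<in> A y" for y v
  proof -
    have "inner x u \<le> t" using fitz zt(1) by (simp add: z)
    with zt(2)[OF graph[OF v]] show ?thesis
      by (simp add: z inner_add_left inner_add_right inner_diff_right inner_commute)
  qed
  have mem: "- x \<in> A (- u)"
  proof (rule maximally_monotone_memI[OF A])
    fix y v assume "v \<in> A y"
    then have "0 \<le> inner (y + u) (v + x)"
      using ineq inner_ge_zero order_trans by blast
    then show "inner (- u - y) (- x - v) \<ge> 0"
      by (simp add: inner_add_left inner_add_right inner_diff_left inner_diff_right)
  qed
  \<comment> \<open>Now the reflected point is itself in the graph and can be used as the test point.\<close>
  from ineq[OF this] have "inner (x + u) (x + u) \<le> 0" by simp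
  then have "x + u = 0" by (metis inner_eq_zero_iff inner_ge_zero antisym)
  then have "u = - x" by (simp add: add_eq_0_iff)
  with mem show ?thesis by auto
qed

lemma maximally_monotone_scale_translate:
  fixes A :: "'a::real_inner \<Rightarrow> 'a set"
  assumes A: "maximally_monotone A" and c: "c > 0"
  shows "maximally_monotone (\<lambda>w. (\<lambda>u. c *\<^sub>R u) ` A (w + z))" (is "maximally_monotone ?B")
proof -
  have "monotone_operator ?B"
    unfolding monotone_operator_def
  proof (intro allI ballI)
    fix x y u v assume "u \<in> ?B x" "v \<in> ?B y"
    then obtain u' v' where *: "u = c *\<^sub>R u'" "u' \<in> A (x + z)" "v = c *\<^sub>R v'" "v' \<in> A (y + z)"
      by blast
    from maximally_monotone_monotone[OF A *(2) *(4)] c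
    show "inner (x - y) (u - v) \<ge> 0"
      by (simp add: * flip: scaleR_diff_right)
  qed
  moreover have "\<not> op_graph ?B \<subset> op_graph B" if B: "monotone_operator B" for B
  proof
    assume sub: "op_graph ?B \<subset> op_graph B"
    then obtain x u where xu: "u \<in> B x" "u \<notin> ?B x"
      by (auto simp: op_graph_def)
    have "inverse c *\<^sub>R u \<in> A (x + z)"
    proof (rule maximally_monotone_memI[OF A])
      fix y v assume v: "v \<in> A y"
      then have "v \<in> A (y - z + z)" by simp
      then have "c *\<^sub>R v \<in> ?B (y - z)" by (rule imageI)
      then have "c *\<^sub>R v \<in> B (y - z)"
        using psubsetD[OF sub, of "(y - z, c *\<^sub>R v)"] by (simp add: op_graph_def)
      with B xu(1) have "0 \<le> inner (x - (y - z)) (u - c *\<^sub>R v)"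
        unfolding monotone_operator_def by blast
      then have "0 \<le> inverse c * inner (x - (y - z)) (u - c *\<^sub>R v)"
        using c by simp
      also have "\<dots> = inner (x + z - y) (inverse c *\<^sub>R (u - c *\<^sub>R v))"
        by (simp add: algebra_simps)
      also have "inverse c *\<^sub>R (u - c *\<^sub>R v) = inverse c *\<^sub>R u - v"
        using c by (simp add: scaleR_diff_right)
      finally show "inner (x + z - y) (inverse c *\<^sub>R u - v) \<ge> 0" .
    qed
    then have "c *\<^sub>R (inverse c *\<^sub>R u) \<in> ?B x" by (rule imageI)
    with c xu(2) show False by simp
  qed
  ultimately show ?thesis unfolding maximally_monotone_def by blast
qed

lemma resolvent_mem:
  fixes A :: "'a::{real_inner,complete_space} \<Rightarrow> 'a set"
  assumes A: "maximally_monotone A" and c: "c > 0"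
  shows "(1 / c) *\<^sub>R (x - resolvent c A x) \<in> A (resolvent c A x)"
proof -
  have iff: "y \<in> resolvent_op c A x \<longleftrightarrow> (1 / c) *\<^sub>R (x - y) \<in> A y" for y
  proof
    assume "y \<in> resolvent_op c A x"
    then obtain u where "x = y + c *\<^sub>R u" "u \<in> A y"
      by (auto simp: resolvent_op_def op_inverse_def)
    with c show "(1 / c) *\<^sub>R (x - y) \<in> A y" by simp
  next
    assume mem: "(1 / c) *\<^sub>R (x - y) \<in> A y"
    have "x = y + c *\<^sub>R ((1 / c) *\<^sub>R (x - y))" using c by simp
    with mem show "y \<in> resolvent_op c A x"
      unfolding resolvent_op_def op_inverse_def by blast
  qed
  obtain w where "- w \<in> (\<lambda>u. c *\<^sub>R u) ` A (w + x)"
    using minty_at_origin[OF maximally_monotone_scale_translate[OF A c]] by blast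
  then obtain u where u: "u \<in> A (w + x)" "- w = c *\<^sub>R u" by blast
  then have "(1 / c) *\<^sub>R (x - (w + x)) = u" using c by simp
  with u(1) have ex: "w + x \<in> resolvent_op c A x" by (simp add: iff)
  have "y = y'" if "y \<in> resolvent_op c A x" "y' \<in> resolvent_op c A x" for y y'
  proof -
    from that have "0 \<le> inner (y - y') ((1 / c) *\<^sub>R (x - y) - (1 / c) *\<^sub>R (x - y'))"
      unfolding iff by (rule maximally_monotone_monotone[OF A])
    also have "(1 / c) *\<^sub>R (x - y) - (1 / c) *\<^sub>R (x - y') = - (1 / c) *\<^sub>R (y - y')"
      by (simp add: algebra_simps)
    finally have "inner (y - y') (y - y') \<le> 0"
      using c by (simp add: divide_le_0_iff)
    then show "y = y'" by (metis inner_eq_zero_iff inner_ge_zero antisym right_minus_eq)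
  qed
  with ex have "resolvent_op c A x = {w + x}" by blast
  then have "resolvent c A x \<in> resolvent_op c A x" by (simp add: resolvent_def)
  then show ?thesis by (simp add: iff)
qed

text \<open>By maximality, membership in the set of zeros is a family of linear inequalities indexed by
  the graph.\<close>

lemma closed_zer:
  assumes A: "maximally_monotone A"
  shows "closed (zer A)"
proof -
  have "zer A = (\<Inter>(y, v)\<in>op_graph A. {x. 0 \<le> inner (x - y) (0 - v)})"
  proof (intro set_eqI iffI)
    fix x assume "x \<in> zer A"
    then show "x \<in> (\<Inter>(y, v)\<in>op_graph A. {x. 0 \<le> inner (x - y) (0 - v)})"
      using maximally_monotone_monotone[OF A, of 0 x]
      by (auto simp: zer_def op_inverse_def op_graph_def)
  next
    fix x assume "x \<in> (\<Inter>(y, v)\<in>op_graph A. {x. 0 \<le> inner (x - y) (0 - v)})"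
    then show "x \<in> zer A"
      unfolding zer_def op_inverse_def mem_Collect_eq
      by (intro maximally_monotone_memI[OF A]) (auto simp: op_graph_def)
  qed
  also have "closed \<dots>"
    by (auto intro!: closed_INT closed_Collect_le continuous_intros)
  finally show ?thesis .
qed

section \<open>One relaxed proximal step\<close>

lemma resolvent_inner_nonneg:
  fixes A :: "'a::{real_inner,complete_space} \<Rightarrow> 'a set"
  assumes A: "maximally_monotone A" and c: "c > 0" and z: "z \<in> zer A"
  shows "inner (x - resolvent c A x) (resolvent c A x - z) \<ge> 0"
proof -
  have "0 \<in> A z" using z by (simp add: zer_def op_inverse_def)
  from maximally_monotone_monotone[OF A resolvent_mem[OF A c, of x] this] c
  show ?thesis by (simp add: inner_commute zero_le_mult_iff zero_le_divide_iff)
qed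

lemma power2_norm_diff:
  fixes a b :: "'a::real_inner"
  shows "(norm (a - b))\<^sup>2 = (norm a)\<^sup>2 - 2 * inner a b + (norm b)\<^sup>2"
  by (simp add: power2_norm_eq_inner inner_diff_left inner_diff_right inner_commute)

text \<open>The resolvent is firmly nonexpansive around zeros, and relaxing by \<open>l\<close> keeps the fraction
  \<open>l * (2 - l)\<close> of its decrease.\<close>

lemma relaxed_step_decrease:
  fixes A :: "'a::{real_inner,complete_space} \<Rightarrow> 'a set"
  assumes A: "maximally_monotone A" and c: "c > 0" and z: "z \<in> zer A" and l: "0 \<le> l"
    and y: "y = (1 - l) *\<^sub>R x + l *\<^sub>R resolvent c A x"
  shows "(norm (y - z))\<^sup>2 \<le> (norm (x - z))\<^sup>2 - l * (2 - l) * (norm (x - resolvent c A x))\<^sup>2"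
proof -
  define r where "r = x - resolvent c A x"
  have y': "y - z = (x - z) - l *\<^sub>R r" by (simp add: y r_def algebra_simps)
  have "resolvent c A x - z = (x - z) - r" by (simp add: r_def)
  with resolvent_inner_nonneg[OF A c z, of x]
  have "inner r ((x - z) - r) \<ge> 0" by (simp only: r_def)
  then have "inner r r \<le> inner r (x - z)" by (simp only: inner_diff_right)
  then have *: "l * inner r r \<le> l * inner r (x - z)" using l by (rule mult_left_mono)
  have "(norm (y - z))\<^sup>2 = (norm (x - z))\<^sup>2 - 2 * (l * inner r (x - z)) + l\<^sup>2 * inner r r"
    unfolding y' power2_norm_diff
    by (simp add: power_mult_distrib power2_norm_eq_inner inner_commute)
  also have "\<dots> \<le> (norm (x - z))\<^sup>2 - 2 * (l * inner r r) + l\<^sup>2 * inner r r"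
    using * by simp
  also have "\<dots> = (norm (x - z))\<^sup>2 - l * (2 - l) * (norm r)\<^sup>2"
    unfolding power2_norm_eq_inner[of r] by (simp add: power2_eq_square algebra_simps)
  finally show ?thesis by (simp add: r_def)
qed

lemma resolvent_dist_zero_le:
  fixes A :: "'a::{real_inner,complete_space} \<Rightarrow> 'a set"
  assumes "maximally_monotone A" "c > 0" "z \<in> zer A"
  shows "norm (resolvent c A x - z) \<le> norm (x - z)"
proof -
  have "(norm (resolvent c A x - z))\<^sup>2 \<le> (norm (x - z))\<^sup>2 - 1 * (2 - 1) * (norm (x - resolvent c A x))\<^sup>2"
    by (rule relaxed_step_decrease[OF assms]) auto
  also have "\<dots> \<le> (norm (x - z))\<^sup>2" by simp
  finally have "(norm (resolvent c A x - z))\<^sup>2 \<le> (norm (x - z))\<^sup>2" .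
  then show ?thesis by (rule power2_le_imp_le) simp
qed

text \<open>This is where subregularity enters, applied at the resolvent, where the residual divided by
  \<open>c\<close> is an element of the value of \<open>A\<close>. It says that the residual is large compared with the
  distance to the zeros.\<close>

lemma infdist_zer_le_residual:
  fixes A :: "'a::{real_inner,complete_space} \<Rightarrow> 'a set"
  assumes A: "maximally_monotone A" and c: "c > 0"
    and sub: "metrically_subregular_with A xb 0 \<kappa> \<delta>" and x: "x \<in> cball xb \<delta>"
  shows "infdist x (zer A) \<le> (1 + \<kappa> / c) * norm (x - resolvent c A x)"
proof -
  define J where "J = resolvent c A x"
  have xb: "xb \<in> zer A" and \<kappa>: "\<kappa> > 0"
    and subr: "\<And>y. y \<in> cball xb \<delta> \<Longrightarrow> edist_set y (zer A) \<le> ereal \<kappa> * edist_set 0 (A y)"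
    using sub by (auto simp: metrically_subregular_with_def zer_def op_inverse_def)
  have "J \<in> cball xb \<delta>"
    using resolvent_dist_zero_le[OF A c xb, of x] x
    by (simp add: J_def dist_norm norm_minus_commute)
  then have "edist_set J (zer A) \<le> ereal \<kappa> * edist_set 0 (A J)" by (rule subr)
  also have "edist_set 0 (A J) \<le> ereal (norm (0 - (1 / c) *\<^sub>R (x - J)))"
    unfolding edist_set_def J_def using resolvent_mem[OF A c] by (rule INF_lower)
  then have "ereal \<kappa> * edist_set 0 (A J) \<le> ereal \<kappa> * ereal (norm (0 - (1 / c) *\<^sub>R (x - J)))"
    using \<kappa> by (intro ereal_mult_left_mono) auto
  also have "\<dots> = ereal (\<kappa> / c * norm (x - J))" using c by simp
  finally have "infdist J (zer A) \<le> \<kappa> / c * norm (x - J)"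
    using xb by (subst (asm) edist_set_eq_infdist) auto
  moreover have "infdist x (zer A) \<le> infdist J (zer A) + dist x J"
    by (rule infdist_triangle)
  ultimately show ?thesis by (simp add: J_def dist_norm algebra_simps)
qed

lemma le_infdistI:
  assumes "C \<noteq> {}" "\<And>z. z \<in> C \<Longrightarrow> r \<le> dist x z"
  shows "r \<le> infdist x C"
  using assms by (simp add: infdist_def cINF_greatest)

lemma relaxation_ratio_bounds:
  fixes l g :: real
  assumes "l \<in> {0<..<2}" "g \<ge> 1"
  shows "0 \<le> l * (2 - l) / g\<^sup>2" "l * (2 - l) / g\<^sup>2 \<le> 1"
proof -
  have "l * (2 - l) \<le> 1"
    using zero_le_power2[of "l - 1"] by (simp add: power2_eq_square algebra_simps)
  moreover have "1 \<le> g\<^sup>2" using assms(2) by simp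
  ultimately show "l * (2 - l) / g\<^sup>2 \<le> 1" by (simp add: divide_le_eq)
  show "0 \<le> l * (2 - l) / g\<^sup>2" using assms by simp
qed

lemma relaxed_step_contraction:
  fixes A :: "'a::{real_inner,complete_space} \<Rightarrow> 'a set"
  assumes A: "maximally_monotone A" and c: "c > 0" and l: "l \<in> {0<..<2}"
    and y: "y = (1 - l) *\<^sub>R x + l *\<^sub>R resolvent c A x"
    and sub: "metrically_subregular_with A xb 0 \<kappa> \<delta>" and x: "x \<in> cball xb \<delta>"
  shows "infdist y (zer A) \<le> sqrt (1 - l * (2 - l) / (1 + \<kappa> / c)\<^sup>2) * infdist x (zer A)"
proof -
  define d d' g r where "d = infdist x (zer A)" and "d' = infdist y (zer A)"
    and "g = 1 + \<kappa> / c" and "r = norm (x - resolvent c A x)"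
  have xb: "zer A \<noteq> {}" and \<kappa>: "\<kappa> > 0"
    using sub by (auto simp: metrically_subregular_with_def zer_def op_inverse_def)
  have nn: "0 \<le> d" "0 \<le> d'" by (simp_all add: d_def d'_def infdist_nonneg)
  have g: "g \<ge> 1" using \<kappa> c by (simp add: g_def)
  have "d \<le> g * r"
    unfolding d_def g_def r_def by (rule infdist_zer_le_residual[OF A c sub x])
  then have "d\<^sup>2 \<le> (g * r)\<^sup>2" using nn by (intro power_mono)
  then have "d\<^sup>2 / g\<^sup>2 \<le> r\<^sup>2" using g by (simp add: power_mult_distrib divide_le_eq mult.commute)
  then have dr: "l * (2 - l) * (d\<^sup>2 / g\<^sup>2) \<le> l * (2 - l) * r\<^sup>2"
    using l by (intro mult_left_mono) auto
  \<comment> \<open>The distance need not be attained, so the decrease for a single zero is turned into a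
      lower bound for \<open>dist x z\<close> before taking the infimum over \<open>z\<close>.\<close>
  have "sqrt (d'\<^sup>2 + l * (2 - l) * r\<^sup>2) \<le> d"
    unfolding d_def
  proof (rule le_infdistI[OF xb])
    fix z assume z: "z \<in> zer A"
    have "d' \<le> norm (y - z)" using infdist_le[OF z, of y] by (simp add: d'_def dist_norm)
    then have "d'\<^sup>2 \<le> (norm (y - z))\<^sup>2" using nn by (intro power_mono)
    also have "\<dots> \<le> (norm (x - z))\<^sup>2 - l * (2 - l) * r\<^sup>2"
      unfolding r_def using l by (intro relaxed_step_decrease[OF A c z _ y]) auto
    finally show "sqrt (d'\<^sup>2 + l * (2 - l) * r\<^sup>2) \<le> dist x z"
      by (intro real_le_lsqrt) (auto simp: dist_norm)
  qed
  moreover have "0 \<le> d'\<^sup>2 + l * (2 - l) * r\<^sup>2" using l by simp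
  ultimately have "d'\<^sup>2 + l * (2 - l) * r\<^sup>2 \<le> d\<^sup>2" by (metis sqrt_le_D)
  with dr have "d'\<^sup>2 \<le> (1 - l * (2 - l) / g\<^sup>2) * d\<^sup>2" by (simp add: algebra_simps)
  then have "sqrt (d'\<^sup>2) \<le> sqrt ((1 - l * (2 - l) / g\<^sup>2) * d\<^sup>2)"
    by (rule real_sqrt_le_mono)
  then show ?thesis using nn by (simp add: real_sqrt_mult d_def d'_def g_def)
qed

section \<open>Fejer monotone sequences\<close>

lemma fejer_monotone_le:
  assumes "fejer_monotone x C" "z \<in> C" "k \<le> m"
  shows "norm (x m - z) \<le> norm (x k - z)"
  using assms(3)
proof (induction m rule: dec_induct)
  case (step n)
  have "norm (x (Suc n) - z) \<le> norm (x n - z)"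
    using assms(1,2) by (simp add: fejer_monotone_def)
  with step show ?case by simp
qed simp

text \<open>Both points lie in the ball around any \<open>z \<in> C\<close> with \<open>x k\<close> on its boundary; the infimum over
  \<open>z\<close> gives the factor 2 of the convergence estimate.\<close>

lemma fejer_monotone_dist_le:
  assumes F: "fejer_monotone x C" and C: "C \<noteq> {}" and km: "k \<le> m"
  shows "dist (x k) (x m) \<le> 2 * infdist (x k) C"
proof -
  have "dist (x k) (x m) / 2 \<le> infdist (x k) C"
  proof (rule le_infdistI[OF C])
    fix z assume z: "z \<in> C"
    have "dist (x k) (x m) \<le> dist (x k) z + dist (x m) z" by (rule dist_triangle2)
    with fejer_monotone_le[OF F z km] show "dist (x k) (x m) / 2 \<le> dist (x k) z"
      by (simp add: dist_norm)
  qed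
  then show ?thesis by simp
qed

lemma fejer_monotone_convergent:
  fixes x :: "nat \<Rightarrow> 'a::{real_normed_vector,complete_space}"
  assumes F: "fejer_monotone x C" and C: "C \<noteq> {}" "closed C"
    and lim: "(\<lambda>k. infdist (x k) C) \<longlonglongrightarrow> 0"
  obtains xh where "xh \<in> C" "x \<longlonglongrightarrow> xh" "\<And>k. norm (x k - xh) \<le> 2 * infdist (x k) C"
proof -
  have "Cauchy x"
  proof (rule metric_CauchyI)
    fix e :: real assume e: "e > 0"
    then have "eventually (\<lambda>k. infdist (x k) C < e / 4) sequentially"
      using order_tendstoD(2)[OF lim, of "e / 4"] by simp
    then obtain N where N: "infdist (x N) C < e / 4" by (auto simp: eventually_sequentially)
    have near: "dist (x N) (x m) < e / 2" if "N \<le> m" for m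
      using fejer_monotone_dist_le[OF F C(1) that] N by linarith
    have "dist (x i) (x j) < e" if "i \<ge> N" "j \<ge> N" for i j
      using dist_triangle3[of "x i" "x j" "x N"] near[OF that(1)] near[OF that(2)] by linarith
    then show "\<exists>N. \<forall>i\<ge>N. \<forall>j\<ge>N. dist (x i) (x j) < e" by blast
  qed
  then obtain xh where xh: "x \<longlonglongrightarrow> xh" using Cauchy_convergent convergent_def by blast
  have "(\<lambda>k. infdist (x k) C) \<longlonglongrightarrow> infdist xh C"
    using xh by (rule tendsto_infdist)
  with lim have "infdist xh C = 0" using LIMSEQ_unique by blast
  then have mem: "xh \<in> C" using C by (simp add: in_closed_iff_infdist_zero)
  have "norm (x k - xh) \<le> 2 * infdist (x k) C" for k
  proof (rule tendsto_upperbound)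
    show "(\<lambda>m. dist (x k) (x m)) \<longlonglongrightarrow> norm (x k - xh)"
      unfolding dist_norm by (intro tendsto_intros xh)
    show "eventually (\<lambda>m. dist (x k) (x m) \<le> 2 * infdist (x k) C) sequentially"
      using eventually_ge_at_top[of k]
      by eventually_elim (rule fejer_monotone_dist_le[OF F C(1)])
  qed simp
  with mem xh that show ?thesis by blast
qed

text \<open>For \<open>z \<in> C\<close> the whole line through \<open>xh\<close> and \<open>z\<close> lies in \<open>C\<close>. Comparing the distances of
  \<open>x 0\<close> and \<open>xh\<close> to points far out on it, in either direction, forces \<open>x 0 - xh\<close> to be orthogonal to
  the line, so \<open>xh\<close> is the foot of the perpendicular.\<close>

lemma fejer_monotone_affine_limit:
  fixes x :: "nat \<Rightarrow> 'a::real_inner"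
  assumes F: "fejer_monotone x C" and aff: "affine C" and xh: "xh \<in> C" "x \<longlonglongrightarrow> xh"
  shows "xh = metric_projection C (x 0)"
proof -
  have orth: "inner (x 0 - xh) (z - xh) = 0" if z: "z \<in> C" for z
  proof (rule ccontr)
    define i where "i = inner (x 0 - xh) (z - xh)"
    define n where "n = (norm (x 0 - xh))\<^sup>2"
    assume "inner (x 0 - xh) (z - xh) \<noteq> 0"
    then have i: "i \<noteq> 0" by (simp add: i_def)
    \<comment> \<open>Any parameter with \<open>2 * t * i > n\<close> contradicts Fejer monotonicity.\<close>
    define t where "t = (n + 1) / (2 * i)"
    define w where "w = (1 - t) *\<^sub>R xh + t *\<^sub>R z"
    have "w \<in> C" using aff xh(1) z unfolding affine_def w_def by simp
    have "norm (xh - w) \<le> norm (x 0 - w)"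
    proof (rule tendsto_upperbound)
      show "(\<lambda>m. norm (x m - w)) \<longlonglongrightarrow> norm (xh - w)"
        by (intro tendsto_intros xh)
      show "eventually (\<lambda>m. norm (x m - w) \<le> norm (x 0 - w)) sequentially"
        using fejer_monotone_le[OF F \<open>w \<in> C\<close> le0] by (intro always_eventually allI)
    qed (rule sequentially_bot)
    then have "(norm (xh - w))\<^sup>2 \<le> (norm (x 0 - w))\<^sup>2" by (intro power_mono) auto
    moreover have "xh - w = - (t *\<^sub>R (z - xh))" "x 0 - w = (x 0 - xh) - t *\<^sub>R (z - xh)"
      by (auto simp: w_def algebra_simps)
    ultimately have "(norm (t *\<^sub>R (z - xh)))\<^sup>2 \<le> (norm ((x 0 - xh) - t *\<^sub>R (z - xh)))\<^sup>2"
      by (simp only: norm_minus_cancel)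
    also have "\<dots> = n - 2 * (t * i) + (norm (t *\<^sub>R (z - xh)))\<^sup>2"
      unfolding power2_norm_diff[of "x 0 - xh"] n_def i_def by simp
    finally have "2 * (t * i) \<le> n" by simp
    moreover have "2 * (t * i) = n + 1" using i by (simp add: t_def)
    ultimately show False by simp
  qed
  have pyth: "(norm (x 0 - z))\<^sup>2 = (norm (x 0 - xh))\<^sup>2 + (norm (z - xh))\<^sup>2" if "z \<in> C" for z
    using power2_norm_diff[of "x 0 - xh" "z - xh"] orth[OF that] by simp
  show ?thesis
    unfolding metric_projection_def
  proof (rule sym, rule the_equality, intro conjI ballI)
    fix y assume "y \<in> C"
    from pyth[OF this] have "(norm (x 0 - xh))\<^sup>2 \<le> (norm (x 0 - y))\<^sup>2" by simp
    then show "norm (x 0 - xh) \<le> norm (x 0 - y)" by (rule power2_le_imp_le) simp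
  next
    fix p assume p: "p \<in> C \<and> (\<forall>y\<in>C. norm (x 0 - p) \<le> norm (x 0 - y))"
    then have "(norm (x 0 - p))\<^sup>2 \<le> (norm (x 0 - xh))\<^sup>2" using xh(1) by (intro power_mono) auto
    moreover have "(norm (x 0 - p))\<^sup>2 = (norm (x 0 - xh))\<^sup>2 + (norm (p - xh))\<^sup>2"
      using p by (intro pyth) blast
    ultimately have "(norm (p - xh))\<^sup>2 \<le> 0" by linarith
    then show "p = xh" by simp
  qed (rule xh(1))
qed

lemma geometric_bound_R_linear:
  assumes \<mu>: "0 < \<mu>" "\<mu> < 1" and C: "0 \<le> C"
    and bound: "\<And>k. k \<ge> K \<Longrightarrow> norm (y k - yb) \<le> C * \<mu> ^ (k - K)"
  shows "converges_R_linearly y yb"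
proof -
  \<comment> \<open>Adding 1 keeps the constant positive, so that its roots tend to 1 even if \<open>C = 0\<close>.\<close>
  define D where "D = C / \<mu> ^ K + 1"
  have D: "D > 0" using \<mu> C by (simp add: D_def add_nonneg_pos)
  have bD: "norm (y k - yb) \<le> D * \<mu> ^ k" if "k \<ge> K" for k
  proof -
    have "norm (y k - yb) \<le> C * \<mu> ^ (k - K)" using bound that .
    also have "\<dots> = C / \<mu> ^ K * \<mu> ^ k" using \<mu> that by (simp add: power_diff)
    also have "\<dots> \<le> D * \<mu> ^ k" using \<mu> by (intro mult_right_mono) (auto simp: D_def)
    finally show ?thesis .
  qed
  have "(\<lambda>k. D * \<mu> ^ k) \<longlonglongrightarrow> D * 0"
    using \<mu> by (intro tendsto_mult_left LIMSEQ_realpow_zero) auto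
  then have "(\<lambda>k. D * \<mu> ^ k) \<longlonglongrightarrow> 0" by simp
  moreover have "eventually (\<lambda>k. norm (norm (y k - yb)) \<le> D * \<mu> ^ k) sequentially"
    using eventually_ge_at_top[of K] by eventually_elim (use bD in simp)
  ultimately have "(\<lambda>k. norm (y k - yb)) \<longlonglongrightarrow> 0" by (rule Lim_null_comparison[rotated])
  then have lim: "y \<longlonglongrightarrow> yb" by (rule LIM_zero_cancel[OF tendsto_norm_zero_cancel])
  have "(\<lambda>k. root k D * \<mu>) \<longlonglongrightarrow> 1 * \<mu>"
    using D by (intro tendsto_mult_right LIMSEQ_root_const)
  then have "limsup (\<lambda>k. ereal (root k D * \<mu>)) = ereal \<mu>"
    by (intro lim_imp_Limsup) auto
  moreover have "limsup (\<lambda>k. ereal (root k (norm (y k - yb)))) \<le> limsup (\<lambda>k. ereal (root k D * \<mu>))"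
  proof (rule Limsup_mono)
    have "root k (norm (y k - yb)) \<le> root k D * \<mu>" if "k \<ge> Suc K" for k
    proof -
      have "root k (norm (y k - yb)) \<le> root k (D * \<mu> ^ k)" using bD that by simp
      also have "\<dots> = root k D * \<mu>"
        using that \<mu> by (simp add: real_root_mult real_root_power_cancel)
      finally show ?thesis .
    qed
    then show "eventually (\<lambda>k. ereal (root k (norm (y k - yb))) \<le> ereal (root k D * \<mu>)) sequentially"
      unfolding eventually_sequentially ereal_less_eq(3) by blast
  qed
  ultimately have "limsup (\<lambda>k. ereal (root k (norm (y k - yb)))) \<le> ereal \<mu>" by simp
  also have "\<dots> < 1" using \<mu> by simp
  finally show ?thesis using lim by (simp add: converges_R_linearly_def)
qed

section \<open>The asymptotic rate\<close>

lemma eventually_less_real_limsup: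
  assumes "\<And>k. a \<le> f k" "\<And>k. f k \<le> b" "real_limsup f < r"
  shows "eventually (\<lambda>k. f k < r) sequentially"
proof -
  have "limsup (\<lambda>k. ereal (f k)) < ereal r"
    using ereal_real_limsup[of a f b] assms by (metis ereal_less_eq(3) not_le)
  from Limsup_lessD[OF this] show ?thesis by simp
qed

lemma eventually_greater_real_liminf:
  assumes "\<And>k. a \<le> f k" "\<And>k. f k \<le> b" "r < real_liminf f"
  shows "eventually (\<lambda>k. r < f k) sequentially"
proof -
  have "ereal r < liminf (\<lambda>k. ereal (f k))"
    using ereal_real_liminf[of a f b] assms by (metis ereal_less_eq(3) not_le)
  from less_LiminfD[OF this] show ?thesis by simp
qed

lemma real_limsup_le:
  assumes "\<And>k. a \<le> f k" "\<And>k. f k \<le> b" "eventually (\<lambda>k. f k \<le> r) sequentially"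
  shows "real_limsup f \<le> r"
proof -
  have "limsup (\<lambda>k. ereal (f k)) \<le> ereal r"
    using assms(3) by (intro Limsup_bounded) simp
  then show ?thesis using ereal_real_limsup[of a f b] assms by (metis ereal_less_eq(3))
qed

lemma le_real_limsup:
  assumes "\<And>k. a \<le> f k" "\<And>k. f k \<le> b"
  shows "a \<le> real_limsup f"
proof -
  have "ereal a \<le> limsup (\<lambda>k. ereal (f k))"
    using assms(1) by (intro le_Limsup) auto
  then show ?thesis using ereal_real_limsup[of a f b] assms by (metis ereal_less_eq(3))
qed

text \<open>The rate is monotone in each of \<open>l k\<close>, \<open>2 - l k\<close> and \<open>g k\<close> separately, so it can be bounded
  by perturbing each limit by \<open>e\<close>; the claim follows by continuity as \<open>e\<close> tends to 0.\<close>

lemma real_limsup_rate_le: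
  fixes l g :: "nat \<Rightarrow> real"
  assumes l: "\<And>k. l k \<in> {0<..<2}" and g: "\<And>k. 1 \<le> g k" "\<And>k. g k \<le> G"
    and low: "0 < real_liminf l" and upp: "real_limsup l < 2"
  shows "real_limsup (\<lambda>k. sqrt (1 - l k * (2 - l k) / (g k)\<^sup>2))
     \<le> sqrt (1 - real_liminf l * (2 - real_limsup l) / (real_limsup g)\<^sup>2)"
proof -
  define a b c where "a = real_liminf l" and "b = real_limsup l" and "c = real_limsup g"
  define \<rho> where "\<rho> = (\<lambda>k. sqrt (1 - l k * (2 - l k) / (g k)\<^sup>2))"
  define h where "h = (\<lambda>e. sqrt (1 - (a - e) * (2 - b - e) / (c + e)\<^sup>2))"
  have lb: "0 \<le> l k" "l k \<le> 2" for k using l[of k] by auto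
  have \<rho>b: "0 \<le> \<rho> k" "\<rho> k \<le> 1" for k
    using relaxation_ratio_bounds[OF l[of k] g(1)[of k]] by (auto simp: \<rho>_def)
  have c1: "1 \<le> c" unfolding c_def by (rule le_real_limsup[of 1 g G]) (rule g)+
  have le_h: "real_limsup \<rho> \<le> h e" if e: "0 < e" "e < a" "e < 2 - b" for e
  proof (rule real_limsup_le[OF \<rho>b])
    have "eventually (\<lambda>k. a - e < l k) sequentially"
      by (rule eventually_greater_real_liminf[OF lb]) (use e in \<open>simp add: a_def\<close>)
    moreover have "eventually (\<lambda>k. l k < b + e) sequentially"
      by (rule eventually_less_real_limsup[OF lb]) (use e in \<open>simp add: b_def\<close>)
    moreover have "eventually (\<lambda>k. g k < c + e) sequentially"
      by (rule eventually_less_real_limsup[OF g]) (use e in \<open>simp add: c_def\<close>)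
    ultimately show "eventually (\<lambda>k. \<rho> k \<le> h e) sequentially"
    proof eventually_elim
      case (elim k)
      have "(a - e) * (2 - b - e) \<le> l k * (2 - l k)"
        using elim e by (intro mult_mono) auto
      moreover have "(g k)\<^sup>2 \<le> (c + e)\<^sup>2"
        using elim g(1)[of k] by (intro power_mono) auto
      moreover have "0 < (g k)\<^sup>2" using g(1)[of k] by simp
      moreover have "0 \<le> l k * (2 - l k)" using lb[of k] by simp
      ultimately have "(a - e) * (2 - b - e) / (c + e)\<^sup>2 \<le> l k * (2 - l k) / (g k)\<^sup>2"
        by (intro frac_le)
      then show ?case by (simp add: \<rho>_def h_def)
    qed
  qed
  have "(h \<longlongrightarrow> h 0) (at_right 0)"
    unfolding h_def using c1 by (intro tendsto_intros) auto
  moreover have "eventually (\<lambda>e. real_limsup \<rho> \<le> h e) (at_right 0)"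
  proof -
    have "eventually (\<lambda>e. e \<in> {0<..<min a (2 - b)}) (at_right 0)"
      using low upp by (intro eventually_at_right_real) (auto simp: a_def b_def)
    then show ?thesis by eventually_elim (use le_h in auto)
  qed
  ultimately have "real_limsup \<rho> \<le> h 0"
    by (intro tendsto_lowerbound[of h "h 0" "at_right 0"]) auto
  then show ?thesis by (simp add: \<rho>_def h_def a_def b_def c_def)
qed

lemma sqrt_one_minus_less:
  fixes t :: real
  assumes "0 < t" "t \<le> 1"
  shows "sqrt (1 - t) < 1 / sqrt (1 + t)" "1 / sqrt (1 + t) < 1"
proof -
  have "(1 - t) * (1 + t) < 1" using assms by (simp add: algebra_simps)
  then have "sqrt (1 - t) * sqrt (1 + t) < 1" by (simp flip: real_sqrt_mult)
  then show "sqrt (1 - t) < 1 / sqrt (1 + t)" using assms by (simp add: less_divide_eq)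
  show "1 / sqrt (1 + t) < 1" using assms by simp
qed

theorem theorem5p6:
  fixes A :: "'a::{real_inner,complete_space} \<Rightarrow> 'a set"
    and x :: "nat \<Rightarrow> 'a"
    and lam c :: "nat \<Rightarrow> real"
  assumes "maximally_monotone A"
    and "zer A \<noteq> {}"
    and "\<And>k. lam k \<in> {0<..<2}"
    and "\<And>k. c k > 0"
    and "(INF k. c k) > 0"
    and "\<And>k. x (Suc k) = (1 - lam k) *\<^sub>R x k + lam k *\<^sub>R resolvent (c k) A (x k)"
  shows "fejer_monotone x (zer A) \<and>
    (\<forall>xb \<kappa> \<delta>. xb \<in> zer A \<longrightarrow> metrically_subregular_with A xb 0 \<kappa> \<delta> \<longrightarrow> x 0 \<in> cball xb \<delta> \<longrightarrow>
      (let \<gamma>s = (\<lambda>k. 1 + \<kappa> / c k);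
           \<rho>s = (\<lambda>k. sqrt (1 - lam k * (2 - lam k) / (\<gamma>s k)\<^sup>2))
       in
        (\<forall>k. x k \<in> cball xb \<delta> \<and>
             edist_set (x (Suc k)) (zer A) \<le> ereal (\<rho>s k) * edist_set (x k) (zer A)) \<and>
        (let lam_l = real_liminf lam;
             lam_u = real_limsup lam;
             \<rho> = real_limsup \<rho>s;
             \<gamma> = real_limsup \<gamma>s
         in 0 < lam_l \<and> lam_l \<le> lam_u \<and> lam_u < 2 \<longrightarrow>
          (0 \<le> \<rho> \<and>
           \<rho> \<le> sqrt (1 - lam_l * (2 - lam_u) / \<gamma>\<^sup>2) \<and>
           sqrt (1 - lam_l * (2 - lam_u) / \<gamma>\<^sup>2) < 1 / sqrt (1 + lam_l * (2 - lam_u) / \<gamma>\<^sup>2) \<and>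
           1 / sqrt (1 + lam_l * (2 - lam_u) / \<gamma>\<^sup>2) < 1) \<and>
          (\<exists>K. \<exists>\<mu>\<in>{\<rho><..<1}. \<forall>k\<ge>K.
             edist_set (x (Suc k)) (zer A) \<le> ereal \<mu> * edist_set (x k) (zer A)) \<and>
          (\<exists>xh\<in>zer A.
             (\<exists>K. \<exists>\<mu>\<in>{\<rho><..<1}. \<forall>k\<ge>K.
                ereal (norm (x k - xh)) \<le> ereal (2 * \<mu> ^ (k - K)) * edist_set (x K) (zer A)) \<and>
             converges_R_linearly x xh \<and>
             (affine (zer A) \<longrightarrow> xh = metric_projection (zer A) (x 0))))))"
proof -
  note A = assms(1) and ne = assms(2) and lam = assms(3) and c = assms(4) and iter = assms(6)
  define Z where "Z = zer A"
  have Z: "Z \<noteq> {}" "closed Z" using ne closed_zer[OF A] by (auto simp: Z_def)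
  have fejer: "fejer_monotone x Z"
    unfolding fejer_monotone_def
  proof (intro ballI allI)
    fix z k assume z: "z \<in> Z"
    have l: "0 \<le> lam k" "0 \<le> 2 - lam k" using lam[of k] by auto
    have "(norm (x (Suc k) - z))\<^sup>2
        \<le> (norm (x k - z))\<^sup>2 - lam k * (2 - lam k) * (norm (x k - resolvent (c k) A (x k)))\<^sup>2"
      using relaxed_step_decrease[OF A c _ l(1) iter] z by (simp add: Z_def)
    also have "\<dots> \<le> (norm (x k - z))\<^sup>2" using l by simp
    finally show "norm (x (Suc k) - z) \<le> norm (x k - z)" by (rule power2_le_imp_le) simp
  qed
  have c_inf: "(INF k. c k) \<le> c k" for k
    using c by (intro cINF_lower bdd_belowI2[of _ 0]) (auto intro: less_imp_le)
  have edist: "edist_set y Z = ereal (infdist y Z)" for y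
    using Z(1) by (rule edist_set_eq_infdist)
  show ?thesis
    unfolding Let_def Z_def[symmetric]
  proof (intro conjI[OF fejer] allI impI, goal_cases)
    case (1 xb \<kappa> \<delta>)
    define g where "g = (\<lambda>k. 1 + \<kappa> / c k)"
    define \<rho> where "\<rho> = (\<lambda>k. sqrt (1 - lam k * (2 - lam k) / (1 + \<kappa> / c k)\<^sup>2))"
    have \<kappa>: "\<kappa> > 0" using 1(2) by (simp add: metrically_subregular_with_def)
    have ball: "x k \<in> cball xb \<delta>" for k
      using fejer_monotone_le[OF fejer 1(1), of 0 k] 1(3)
      by (simp add: dist_norm norm_minus_commute)
    have contr: "infdist (x (Suc k)) Z \<le> \<rho> k * infdist (x k) Z" for k
      unfolding \<rho>_def Z_def by (rule relaxed_step_contraction[OF A c lam iter 1(2) ball])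
    have gb: "1 \<le> g k" "g k \<le> 1 + \<kappa> / (INF k. c k)" for k
      using \<kappa> c[of k] c_inf[of k] assms(5) by (auto simp: g_def intro!: divide_left_mono)
    have \<rho>b: "0 \<le> \<rho> k" "\<rho> k \<le> 1" for k
      using relaxation_ratio_bounds[OF lam[of k] gb(1)[of k]] by (auto simp: \<rho>_def g_def)
    show ?case
      unfolding g_def[symmetric] \<rho>_def[symmetric]
    proof (rule conjI[OF _ impI], goal_cases)
      case 1
      show ?case using ball contr by (auto simp: edist \<rho>_def)
    next
      case 2
      define t where "t = real_liminf lam * (2 - real_limsup lam) / (real_limsup g)\<^sup>2"
      have gl: "1 \<le> real_limsup g" by (rule le_real_limsup[of 1 g, OF gb])
      have t: "0 < t" "t \<le> 1"
      proof -
        show "0 < t" using 2 gl by (simp add: t_def)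
        have "t \<le> real_liminf lam * (2 - real_liminf lam) / (real_limsup g)\<^sup>2"
          unfolding t_def using 2 by (intro divide_right_mono mult_left_mono) auto
        also have "\<dots> \<le> 1" using 2 gl by (intro relaxation_ratio_bounds) auto
        finally show "t \<le> 1" .
      qed
      have \<rho>0: "0 \<le> real_limsup \<rho>" by (rule le_real_limsup[of 0 \<rho>, OF \<rho>b])
      have \<rho>t: "real_limsup \<rho> \<le> sqrt (1 - t)"
        using real_limsup_rate_le[OF lam gb] 2 by (simp add: \<rho>_def t_def g_def)
      have "real_limsup \<rho> < 1" using \<rho>t sqrt_one_minus_less[OF t] by linarith
      then obtain \<mu> where \<mu>: "real_limsup \<rho> < \<mu>" "\<mu> < 1" using dense by blast
      have \<mu>0: "0 < \<mu>" using \<rho>0 \<mu> by linarith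
      obtain K where K: "\<And>k. k \<ge> K \<Longrightarrow> \<rho> k < \<mu>"
        using eventually_less_real_limsup[OF \<rho>b \<mu>(1)] by (auto simp: eventually_sequentially)
      have shrink: "infdist (x (Suc k)) Z \<le> \<mu> * infdist (x k) Z" if "k \<ge> K" for k
      proof -
        have "\<rho> k * infdist (x k) Z \<le> \<mu> * infdist (x k) Z"
          using K[OF that] by (intro mult_right_mono) (auto simp: infdist_nonneg)
        with contr[of k] show ?thesis by linarith
      qed
      have geo: "infdist (x k) Z \<le> \<mu> ^ (k - K) * infdist (x K) Z" if "k \<ge> K" for k
        using that
      proof (induction k rule: dec_induct)
        case (step n)
        have "infdist (x (Suc n)) Z \<le> \<mu> * infdist (x n) Z"
          using step(1) by (rule shrink)
        also have "\<dots> \<le> \<mu> * (\<mu> ^ (n - K) * infdist (x K) Z)"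
          using step(3) \<mu>0 by (intro mult_left_mono) auto
        finally show ?case using step(1) by (simp add: Suc_diff_le)
      qed simp
      have "(\<lambda>n. \<mu> ^ n * infdist (x K) Z) \<longlonglongrightarrow> 0 * infdist (x K) Z"
        using \<mu> \<mu>0 by (intro tendsto_mult_right LIMSEQ_realpow_zero) auto
      then have "(\<lambda>n. \<mu> ^ n * infdist (x K) Z) \<longlonglongrightarrow> 0" by simp
      moreover have "norm (infdist (x (n + K)) Z) \<le> \<mu> ^ n * infdist (x K) Z" for n
        using geo[of "n + K"] by (simp add: infdist_nonneg)
      ultimately have "(\<lambda>n. infdist (x (n + K)) Z) \<longlonglongrightarrow> 0"
        by (rule Lim_null_comparison[OF always_eventually[OF allI], rotated])
      then have "(\<lambda>k. infdist (x k) Z) \<longlonglongrightarrow> 0" by (rule LIMSEQ_offset)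
      then obtain xh where xh: "xh \<in> Z" "x \<longlonglongrightarrow> xh"
        "\<And>k. norm (x k - xh) \<le> 2 * infdist (x k) Z"
        using fejer_monotone_convergent[OF fejer Z] by blast
      have rate: "norm (x k - xh) \<le> 2 * \<mu> ^ (k - K) * infdist (x K) Z" if "k \<ge> K" for k
        using xh(3)[of k] geo[OF that] by linarith
      have rlin: "converges_R_linearly x xh"
      proof (rule geometric_bound_R_linear[OF \<mu>0 \<mu>(2)])
        show "0 \<le> 2 * infdist (x K) Z" by (simp add: infdist_nonneg)
        show "norm (x k - xh) \<le> 2 * infdist (x K) Z * \<mu> ^ (k - K)" if "k \<ge> K" for k
          using rate[OF that] by (simp add: mult_ac)
      qed
      have rates: "0 \<le> real_limsup \<rho> \<and> real_limsup \<rho> \<le> sqrt (1 - t) \<and>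
          sqrt (1 - t) < 1 / sqrt (1 + t) \<and> 1 / sqrt (1 + t) < 1"
        using \<rho>0 \<rho>t sqrt_one_minus_less[OF t] by blast
      have ex1: "\<exists>K. \<exists>\<mu>\<in>{real_limsup \<rho><..<1}. \<forall>k\<ge>K.
          edist_set (x (Suc k)) Z \<le> ereal \<mu> * edist_set (x k) Z"
        using shrink \<mu> by (intro exI[of _ K] bexI[of _ \<mu>]) (auto simp: edist)
      have ex2: "\<exists>K. \<exists>\<mu>\<in>{real_limsup \<rho><..<1}. \<forall>k\<ge>K.
          ereal (norm (x k - xh)) \<le> ereal (2 * \<mu> ^ (k - K)) * edist_set (x K) Z"
        using rate \<mu> by (intro exI[of _ K] bexI[of _ \<mu>]) (auto simp: edist)
      have proj: "affine Z \<longrightarrow> xh = metric_projection Z (x 0)"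
        using fejer_monotone_affine_limit[OF fejer _ xh(1,2)] by blast
      show ?case
        using rates ex1 ex2 rlin proj xh(1) unfolding t_def by blast
    qed
  qed
qed

end
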